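(* Let $n\ge 2$, $\delta \in (0, n/(n-1))$, and $A = \delta I + (1-\delta)\mathbf{1}\mathbf{1}^T \in \mathbb{R}^{n\times n}$. Consider minimizing $f(x)=\frac12x^TAx$ using RPCD with exact line search, and let the matrices $\bar A^{(t)}$, $t \ge 0$, be as defined in the context, with $\bar A^{(0)} = A$. Then for every $t \ge 0$, \[ \bar A^{(t)} = \eta_t I + \nu_t \mathbf{1}\mathbf{1}^T , \] where $(\eta_0,\nu_0) = (\delta, 1-\delta)$ and \[ \begin{pmatrix} \eta_{t+1} \\ \nu_{t+1} \end{pmatrix} = M \begin{pmatrix} \eta_t \\ \nu_t \end{pmatrix} = M^{t+1}\begin{pmatrix} \delta \\ 1-\delta \end{pmatrix} \quad \text{for all } t\ge 0, \qquad M := \begin{pmatrix} d_1 & m_1 \\ d_2 & m_2 \end{pmatrix}, \] with $d_1,d_2,m_1,m_2$ the scalars defined in the context.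
   Context: $\mathbf{1} = (1,1,\dots,1)^T \in \mathbb{R}^n$, $\|\cdot\|$ is the Euclidean norm, $\|\cdot\|_F$ the Frobenius norm. The matrix $A$ has unit diagonal and satisfies $P^TAP=A$ for every permutation matrix $P$. Write $A = L + D + L^T$ with $L$ strictly lower triangular and $D = I$ the diagonal of $A$, and let $C = -(L+D)^{-1}L^T$. RPCD (random-permutations cyclic coordinate descent) with exact line search draws, at the start of each epoch, an independent uniformly random permutation of $\{1,\dots,n\}$ and then, going through the coordinates $i$ in that order, performs $x \leftarrow x - (Ax)_i e_i$ ($e_i$ being the $i$th standard basis vector). If $P_l$ is the permutation matrix representing the $l$th permutation, the iterate after $\ell$ epochs is \[ x^{\ell n} = P_\ell C P_\ell^T \cdots P_1 C P_1^T x^0 . \] The matrices $\bar A^{(t)}$ are defined, for $0\le t\le \ell$, by \[ \bar A^{(t)} = \mathbb{E}_{P_{\ell-t+1},\dots,P_\ell}\left( P_{\ell-t+1}C^TP_{\ell-t+1}^T\cdots P_\ell C^T P_\ell^T\, A\, P_\ell C P_\ell^T \cdots P_{\ell-t+1} C P_{\ell-t+1}^T\right), \] where $P_1,\dots,P_\ell$ are i.i.d. uniformly random $n\times n$ permutation matrices; equivalently (and independently of $\ell$), $\bar A^{(0)} = A$ and \[ \bar A^{(t)} = \mathbb{E}_P\left( P C^T P^T \bar A^{(t-1)} P C P^T \right), \quad t \ge 1, \] with $P$ a uniformly random permutation matrix. The scalars are \[ d_2 = \frac{\|C\mathbf{1}\|^2 - \|C\|_F^2}{n(n-1)},\quad d_1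 = \frac{\|C\|_F^2}{n} - d_2,\quad m_2 = \frac{(\mathbf{1}^TC\mathbf{1})^2 - \|C^T\mathbf{1}\|^2}{n(n-1)},\quad m_1 = \frac{\|C^T\mathbf{1}\|^2}{n} - m_2 . \] *)

theory Defs
  imports "HOL-Probability.Probability"
begin

text \<open>
  The order of the coordinates $1,\dots,n$ is that of an index type of class linorder.
  The constant \<open>1 :: real^'n\<close> is the all-ones vector, and the library norm on
  \<open>real^'n^'n\<close> is the Frobenius norm.
\<close>

definition ones_mat :: "real^'n^'n" where
  "ones_mat = (columnvector 1 :: real^1^'n) ** (rowvector 1 :: real^'n^1)"

definition strict_lower :: "real^('n::{finite,linorder})^('n::{finite,linorder})
    \<Rightarrow> real^('n::{finite,linorder})^('n::{finite,linorder})" where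
  "strict_lower A = (\<chi> i j. if j < i then A $ i $ j else 0)"

definition diag_part :: "real^'n^'n \<Rightarrow> real^'n^'n" where
  "diag_part A = (\<chi> i j. if i = j then A $ i $ j else 0)"

definition cd_mat :: "real^('n::{finite,linorder})^('n::{finite,linorder})
    \<Rightarrow> real^('n::{finite,linorder})^('n::{finite,linorder})" where
  "cd_mat A = - (matrix_inv (strict_lower A + diag_part A) ** transpose (strict_lower A))"

text \<open>
  The matrix of a permutation \<open>p\<close> sends $e_j$ to $e_{p(j)}$, so that, for permutation-invariant $A$,
  \<open>P C P\<^sup>T\<close> is the coordinate descent epoch in the order $p(1), p(2), \dots, p(n)$.
\<close>

definition perm_mat :: "('n \<Rightarrow> 'n) \<Rightarrow> real^'n^'n" where
  "perm_mat p = (\<chi> i j. if i = p j then 1 else 0)"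

definition perm_conj :: "real^'n^'n \<Rightarrow> ('n \<Rightarrow> 'n) \<Rightarrow> real^'n^'n" where
  "perm_conj B p = perm_mat p ** B ** transpose (perm_mat p)"

text \<open>
  For $t \le l$, with $P_k$ the matrix of \<open>p k\<close>, this is
  $$P_{l-t+1} C^T P_{l-t+1}^T \cdots P_l C^T P_l^T \, A \, P_l C P_l^T \cdots P_{l-t+1} C P_{l-t+1}^T.$$
  Passing from $t$ to $t+1$ adds the outermost pair of factors, whose index is $l - t$.
\<close>

primrec epoch_product ::
  "real^('n::{finite,linorder})^('n::{finite,linorder}) \<Rightarrow> nat \<Rightarrow> nat
    \<Rightarrow> (nat \<Rightarrow> 'n \<Rightarrow> 'n) \<Rightarrow> real^('n::{finite,linorder})^('n::{finite,linorder})" where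
  "epoch_product A l 0 p = A"
| "epoch_product A l (Suc t) p =
     perm_conj (transpose (cd_mat A)) (p (l - t)) ** epoch_product A l t p
       ** perm_conj (cd_mat A) (p (l - t))"

definition random_perms :: "nat set \<Rightarrow> (nat \<Rightarrow> 'n::finite \<Rightarrow> 'n) pmf" where
  "random_perms K = Pi_pmf K id (\<lambda>_. pmf_of_set {p. p permutes UNIV})"

text \<open>Meaningful for $t \le l$ only.\<close>

definition A_bar :: "real^('n::{finite,linorder})^('n::{finite,linorder}) \<Rightarrow> nat \<Rightarrow> nat
    \<Rightarrow> real^('n::{finite,linorder})^('n::{finite,linorder})" where
  "A_bar A l t = measure_pmf.expectation (random_perms {l - t + 1..l}) (epoch_product A l t)"

definition d2 :: "real^'n^'n \<Rightarrow> real" where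
  "d2 C = ((norm (C *v 1))\<^sup>2 - (norm C)\<^sup>2) / (real CARD('n) * (real CARD('n) - 1))"

definition d1 :: "real^'n^'n \<Rightarrow> real" where
  "d1 C = (norm C)\<^sup>2 / real CARD('n) - d2 C"

definition m2 :: "real^'n^'n \<Rightarrow> real" where
  "m2 C = ((1 \<bullet> (C *v 1))\<^sup>2 - (norm (transpose C *v 1))\<^sup>2)
            / (real CARD('n) * (real CARD('n) - 1))"

definition m1 :: "real^'n^'n \<Rightarrow> real" where
  "m1 C = (norm (transpose C *v 1))\<^sup>2 / real CARD('n) - m2 C"

definition M_mat :: "real^'n^'n \<Rightarrow> real^2^2" where
  "M_mat C = vector [vector [d1 C, m1 C], vector [d2 C, m2 C]]"

text \<open>The library power \<open>M ^ k\<close> on \<open>real^'n^'n\<close> is componentwise, hence a separate matrix power.\<close>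

primrec matpow :: "real^'n^'n \<Rightarrow> nat \<Rightarrow> real^'n^'n" where
  "matpow M 0 = mat 1"
| "matpow M (Suc k) = M ** matpow M k"

end

theory Submission
  imports Defs
begin

text \<open>
  The mean of $P X P^T$ over all permutation matrices $P$ is invariant under conjugation by
  permutations, so its diagonal is constant and so are its off-diagonal entries; hence it is
  $a I + b \mathbf{1}\mathbf{1}^T$, and $a$, $b$ are determined by the trace and the sum of all
  entries, which conjugation preserves. Matrices of the form $\eta I + \nu \mathbf{1}\mathbf{1}^T$
  commute with every $P$, so one epoch averages $P (C^T (\eta I + \nu \mathbf{1}\mathbf{1}^T) C) P^T$,
  whose trace and entry sum are linear in $(\eta, \nu)$ with the coefficients collected in $M$.
\<close>

section \<open>Linear maps and expectations over finite supports\<close>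

lemma ones_mat_nth [simp]: "ones_mat $ i $ j = 1"
  by (simp add: ones_mat_def matrix_matrix_mult_def columnvector_def rowvector_def)

lemma linear_sandwich: "linear (\<lambda>X :: real^'n^'n. G ** X ** H)"
  for G :: "real^'n^'m" and H :: "real^'k^'n"
proof (rule linearI)
  fix X Y :: "real^'n^'n" and c :: real
  show "G ** (X + Y) ** H = G ** X ** H + G ** Y ** H"
    by (simp add: vec_eq_iff matrix_matrix_mult_def ring_distribs sum.distrib)
  show "G ** (c *\<^sub>R X) ** H = c *\<^sub>R (G ** X ** H)"
    by (simp add: vec_eq_iff matrix_matrix_mult_def sum_distrib_left sum_distrib_right mult_ac)
qed

text \<open>A finite support makes every function integrable, and a linear map between Euclidean
  spaces is bounded, so it can be pulled out of the expectation.\<close>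

lemma expectation_linear:
  fixes F :: "'a::euclidean_space \<Rightarrow> 'b::euclidean_space"
  assumes "linear F" "finite (set_pmf M)"
  shows "measure_pmf.expectation M (\<lambda>x. F (f x)) = F (measure_pmf.expectation M f)"
  using assms
  by (intro integral_bounded_linear integrable_measure_pmf_finite)
     (auto simp: linear_conv_bounded_linear)

text \<open>The tower rule: it allows the permutation of one epoch to be averaged separately from
  the others.\<close>

lemma expectation_bind_pmf_finite:
  fixes h :: "'b \<Rightarrow> 'c::{banach, second_countable_topology}"
  assumes "finite (set_pmf p)" "\<And>x. x \<in> set_pmf p \<Longrightarrow> finite (set_pmf (f x))"
  shows "measure_pmf.expectation (p \<bind> f) h
           = measure_pmf.expectation p (\<lambda>x. measure_pmf.expectation (f x) h)"
  using assms by (subst pmf_expectation_bind[of "set_pmf p"], auto)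
    (subst integral_measure_pmf[of "set_pmf p"], auto)

section \<open>Uniformly random permutations\<close>

definition random_perm :: "('n::finite \<Rightarrow> 'n) pmf" where
  "random_perm = pmf_of_set {p. p permutes UNIV}"

lemma finite_set_random_perm [simp]: "finite (set_pmf (random_perm :: ('n::finite \<Rightarrow> 'n) pmf))"
  by (rule finite)

lemma set_random_perm: "set_pmf (random_perm :: ('n::finite \<Rightarrow> 'n) pmf) = {p. p permutes UNIV}"
  unfolding random_perm_def
  by (rule set_pmf_of_set) (auto intro: permutes_id exI[of _ id])

text \<open>Left multiplication by \<open>q\<close> is a bijection of the symmetric group, with
  inverse left multiplication by \<open>inv q\<close>, so it preserves the uniform law.\<close>

lemma map_comp_random_perm:
  assumes "q permutes (UNIV :: 'n::finite set)"
  shows "map_pmf ((\<circ>) q) random_perm = random_perm"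
  unfolding random_perm_def
proof (rule map_pmf_of_set_bij_betw)
  show "bij_betw ((\<circ>) q) {p. p permutes UNIV} {p. p permutes UNIV}"
  proof (rule bij_betw_byWitness[where f' = "(\<circ>) (inv q)"])
    show "\<forall>p\<in>{p. p permutes UNIV}. inv q \<circ> (q \<circ> p) = p"
      using assms by (simp add: fun_eq_iff permutes_inverses)
    show "\<forall>p\<in>{p. p permutes UNIV}. q \<circ> (inv q \<circ> p) = p"
      using assms by (simp add: fun_eq_iff permutes_inverses)
  qed (use assms in \<open>auto intro: permutes_compose permutes_inv\<close>)
qed (auto intro: permutes_id exI[of _ id])

lemma finite_set_random_perms:
  assumes "finite K"
  shows "finite (set_pmf (random_perms K :: (nat \<Rightarrow> 'n::finite \<Rightarrow> 'n) pmf))"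
  using assms by (auto simp: random_perms_def set_Pi_pmf intro!: finite_PiE_dflt)

section \<open>Permutation matrices and conjugation\<close>

text \<open>Column \<open>j\<close> of \<open>perm_mat p\<close> is the basis vector with index
  \<open>p j\<close>, so this product merely relabels indices.\<close>

lemma perm_mat_sandwich:
  "(transpose (perm_mat p) ** X ** perm_mat p) $ i $ j = X $ p i $ p j"
  by (simp add: perm_mat_def matrix_matrix_mult_def transpose_def if_distrib if_distribR
      cong: if_cong)

lemma perm_mat_orthogonal:
  assumes "p permutes UNIV"
  shows "transpose (perm_mat p) ** perm_mat p = mat 1"
  using perm_mat_sandwich[of p "mat 1"] permutes_inj[OF assms]
  unfolding matrix_mul_rid by (simp add: vec_eq_iff) (simp add: mat_def inj_eq)

text \<open>Each column of \<open>perm_mat p\<close> contains exactly one 1, so all column sums are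
  1.\<close>

lemma ones_mul_perm_mat: "1 v* perm_mat p = 1"
  by (simp add: vec_eq_iff perm_mat_def vector_matrix_mult_def)

lemma perm_conj_nth_perm:
  assumes "p permutes UNIV"
  shows "perm_conj X p $ p i $ p j = X $ i $ j"
proof -
  have "transpose (perm_mat p) ** perm_conj X p ** perm_mat p
      = (transpose (perm_mat p) ** perm_mat p) ** X ** (transpose (perm_mat p) ** perm_mat p)"
    by (simp only: perm_conj_def matrix_mul_assoc)
  also have "\<dots> = X"
    by (simp add: perm_mat_orthogonal[OF assms])
  finally show ?thesis
    by (metis perm_mat_sandwich)
qed

text \<open>Cyclicity of the trace brings the two permutation matrices together, where they cancel
  by orthogonality.\<close>

lemma trace_perm_conj:
  assumes "p permutes UNIV"
  shows "trace (perm_conj X p) = trace X"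
proof -
  have "trace (perm_conj X p) = trace (transpose (perm_mat p) ** perm_mat p ** X)"
    unfolding perm_conj_def by (subst trace_mul_sym) (simp add: matrix_mul_assoc)
  thus ?thesis
    by (simp add: perm_mat_orthogonal[OF assms])
qed

text \<open>The all-ones vector absorbs the permutation matrix on either side.\<close>

lemma grand_sum_perm_conj: "1 \<bullet> (perm_conj X p *v 1) = 1 \<bullet> (X *v 1)"
proof -
  have "1 \<bullet> (perm_conj X p *v 1) = 1 \<bullet> (perm_mat p *v (X *v 1))"
    by (simp add: perm_conj_def ones_mul_perm_mat flip: matrix_vector_mul_assoc)
  also have "\<dots> = (1 v* perm_mat p) \<bullet> (X *v 1)"
    by (simp only: dot_lmul_matrix)
  finally show ?thesis
    by (simp add: ones_mul_perm_mat)
qed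

section \<open>Permutation-invariant matrices and the mean of conjugates\<close>

text \<open>Double transitivity: \<open>r\<close> swaps \<open>i\<close> into place, then a second
  swap moves \<open>r j\<close> to \<open>j'\<close>. The second swap fixes \<open>i'\<close>, which
  differs from both \<open>r j\<close> and \<open>j'\<close>.\<close>

lemma ex_permutes_pair:
  assumes "i \<noteq> j" "i' \<noteq> j'"
  obtains q where "q permutes UNIV" "q i = i'" "q j = j'"
proof
  define r where "r = Transposition.transpose i i'"
  define q where "q = Transposition.transpose (r j) j' \<circ> r"
  have "r permutes UNIV"
    by (simp add: r_def permutes_swap_id)
  thus "q permutes UNIV"
    unfolding q_def by (intro permutes_compose permutes_swap_id) auto
  show "q j = j'"
    by (simp add: q_def)
  have "r j \<noteq> i'"
    using assms by (auto simp: r_def Transposition.transpose_def)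
  thus "q i = i'"
    using assms by (simp add: q_def r_def Transposition.transpose_def)
qed

text \<open>By double transitivity there is one diagonal value \<open>d\<close> and one off-diagonal
  value \<open>e\<close>. The trace is n d and the entry sum is n (d + (n - 1) e); solving for
  \<open>e\<close> gives \<open>b\<close>, where n >= 2 keeps the denominator nonzero.\<close>

lemma perm_invariant_eq:
  fixes X :: "real^'n^'n"
  assumes "CARD('n) \<ge> 2"
    and inv: "\<And>q i j. q permutes UNIV \<Longrightarrow> X $ q i $ q j = X $ i $ j"
  defines "b \<equiv> (1 \<bullet> (X *v 1) - trace X) / (real CARD('n) * (real CARD('n) - 1))"
  shows "X = (trace X / real CARD('n) - b) *\<^sub>R mat 1 + b *\<^sub>R ones_mat"
proof -
  let ?n = "real CARD('n)"
  have "\<exists>u v :: 'n. u \<noteq> v"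
    using assms(1) card_le_Suc0_iff_eq[of "UNIV :: 'n set"] by auto
  then obtain u v :: 'n where uv: "u \<noteq> v" by blast
  define d where "d = X $ u $ u"
  define e where "e = X $ u $ v"
  have X: "X $ i $ j = (if i = j then d else e)" for i j
  proof (cases "i = j")
    case True
    then show ?thesis
      using inv[of "Transposition.transpose u i" u u] by (simp add: d_def permutes_swap_id)
  next
    case False
    then obtain q where "q permutes UNIV" "q u = i" "q v = j"
      using ex_permutes_pair uv by metis
    then show ?thesis
      using inv[of q u v] False by (simp add: e_def)
  qed
  have tr: "trace X = ?n * d"
    by (simp add: trace_def X)
  have row: "(\<Sum>j\<in>UNIV. if i = j then d else e) = d + (?n - 1) * e" for i :: 'n
  proof -
    have "(\<Sum>j\<in>UNIV. if i = j then d else e) = (\<Sum>j\<in>UNIV. e + (if i = j then d - e else 0))"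
      by (intro sum.cong) auto
    then show ?thesis
      by (simp add: sum.distrib algebra_simps)
  qed
  have "1 \<bullet> (X *v 1) = ?n * (d + (?n - 1) * e)"
    by (simp add: inner_vec_def matrix_vector_mult_def X row)
  hence "b = e"
    using assms(1) tr by (simp add: b_def field_simps)
  thus ?thesis
    using tr assms(1) by (simp add: vec_eq_iff X mat_def)
qed

lemma linear_perm_conj: "linear (\<lambda>X. perm_conj X p)"
  unfolding perm_conj_def by (rule linear_sandwich)

lemma perm_conj_comp: "perm_conj X (q \<circ> p) = perm_conj (perm_conj X p) q"
proof -
  have "perm_mat (q \<circ> p) = perm_mat q ** perm_mat p"
    by (simp add: vec_eq_iff perm_mat_def matrix_matrix_mult_def if_distrib[of "(*) _"] cong: if_cong)
  thus ?thesis
    by (simp add: perm_conj_def matrix_transpose_mul matrix_mul_assoc)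
qed

lemma expectation_perm_conj:
  fixes X :: "real^'n^'n"
  assumes "CARD('n) \<ge> 2"
  defines "b \<equiv> (1 \<bullet> (X *v 1) - trace X) / (real CARD('n) * (real CARD('n) - 1))"
  shows "measure_pmf.expectation random_perm (perm_conj X)
           = (trace X / real CARD('n) - b) *\<^sub>R mat 1 + b *\<^sub>R ones_mat"
proof -
  define E where "E = measure_pmf.expectation random_perm (perm_conj X)"
  \<comment> \<open>Replacing the random \<open>p\<close> by \<open>q \<circ> p\<close> leaves its
    law unchanged but conjugates the mean by \<open>q\<close>.\<close>
  have "E = perm_conj E q" if "q permutes UNIV" for q
  proof -
    have "E = measure_pmf.expectation (map_pmf ((\<circ>) q) random_perm) (perm_conj X)"
      by (simp add: E_def map_comp_random_perm[OF that])
    also have "\<dots> = measure_pmf.expectation random_perm (\<lambda>p. perm_conj (perm_conj X p) q)"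
      by (simp add: perm_conj_comp)
    also have "\<dots> = perm_conj E q"
      unfolding E_def by (rule expectation_linear[OF linear_perm_conj]) simp
    finally show ?thesis .
  qed
  hence inv: "E $ q i $ q j = E $ i $ j" if "q permutes UNIV" for q i j
    using perm_conj_nth_perm[OF that] that by metis
  \<comment> \<open>A linear functional passes through the mean, and it takes the value
    \<open>F X\<close> on every conjugate. This serves for both the trace and the entry sum.\<close>
  have preserved: "F E = F X"
    if "linear F" "\<And>p. p permutes UNIV \<Longrightarrow> F (perm_conj X p) = F X" for F :: "real^'n^'n \<Rightarrow> real"
  proof -
    have "F E = measure_pmf.expectation random_perm (\<lambda>p. F (perm_conj X p))"
      unfolding E_def by (rule expectation_linear[symmetric]) (use that in auto)
    also have "\<dots> = measure_pmf.expectation random_perm (\<lambda>_ :: 'n \<Rightarrow> 'n. F X)"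
      by (intro integral_cong_AE) (auto simp: AE_measure_pmf_iff set_random_perm that)
    finally show ?thesis by simp
  qed
  have "linear (trace :: real^'n^'n \<Rightarrow> real)"
    by (auto simp: trace_def sum.distrib sum_distrib_left intro!: linearI)
  hence "trace E = trace X"
    by (rule preserved) (rule trace_perm_conj)
  moreover have "1 \<bullet> (E *v 1) = 1 \<bullet> (X *v 1)"
    by (rule preserved)
       (auto simp: grand_sum_perm_conj inner_right_distrib matrix_vector_mult_add_rdistrib
          scaleR_matrix_vector_assoc[symmetric] intro!: linearI)
  ultimately show ?thesis
    using perm_invariant_eq[OF assms(1) inv] by (simp add: E_def b_def)
qed

section \<open>One-step recursion for the averaged matrices\<close>

lemma epoch_product_cong:
  assumes "t \<le> l" "\<And>k. k \<in> {l - t + 1..l} \<Longrightarrow> p k = p' k"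
  shows "epoch_product A l t p = epoch_product A l t p'"
  using assms
proof (induction t)
  case (Suc t)
  have "p (l - t) = p' (l - t)"
    using Suc.prems by auto
  moreover have "epoch_product A l t p = epoch_product A l t p'"
    using Suc.prems by (intro Suc.IH) auto
  ultimately show ?case
    by simp
qed simp

lemma A_bar_0 [simp]: "A_bar A l 0 = A"
proof -
  have "epoch_product A l 0 = (\<lambda>_. A)"
    by (rule ext) simp
  thus ?thesis
    by (simp add: A_bar_def)
qed

text \<open>The permutation with index \<open>l - t\<close> is independent of those inside
  \<open>epoch_product A l t\<close>. Averaging over the latter first turns the inner product into
  \<open>A_bar A l t\<close>, because the outer factors act linearly on it.\<close>

lemma A_bar_Suc:
  assumes "t < l"
  shows "A_bar A l (Suc t) = measure_pmf.expectation random_perm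
           (\<lambda>q. perm_conj (transpose (cd_mat A)) q ** A_bar A l t ** perm_conj (cd_mat A) q)"
proof -
  define K where "K = {l - t + 1..l}"
  \<comment> \<open>Subtraction is truncated on \<open>nat\<close>; \<open>t < l\<close> ensures
    that the window grows by exactly the index \<open>l - t\<close>.\<close>
  have K: "{l - Suc t + 1..l} = insert (l - t) K" "finite K" "l - t \<notin> K"
    using assms by (auto simp: K_def)
  have split: "random_perms (insert (l - t) K)
      = random_perm \<bind> (\<lambda>q. map_pmf (\<lambda>f. f(l - t := q)) (random_perms K))"
    using K(2,3) by (simp add: random_perms_def random_perm_def Pi_pmf_insert' map_pmf_def)
  \<comment> \<open>The old window starts at \<open>l - t + 1\<close>, so the inner product does not
    see the new value.\<close>
  have upd: "epoch_product A l t (f(l - t := q)) = epoch_product A l t f" for f q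
    using assms by (intro epoch_product_cong) auto
  let ?G = "\<lambda>q. perm_conj (transpose (cd_mat A)) q" and ?H = "\<lambda>q. perm_conj (cd_mat A) q"
  have "A_bar A l (Suc t) = measure_pmf.expectation random_perm
          (\<lambda>q. measure_pmf.expectation (random_perms K)
                 (\<lambda>f. ?G q ** epoch_product A l t f ** ?H q))"
    unfolding A_bar_def K(1) split using K(2)
    by (subst expectation_bind_pmf_finite) (simp_all add: finite_set_random_perms upd)
  also have "\<dots> = measure_pmf.expectation random_perm (\<lambda>q. ?G q ** A_bar A l t ** ?H q)"
    unfolding A_bar_def K_def[symmetric]
    by (subst expectation_linear[OF linear_sandwich]) (simp_all add: finite_set_random_perms K(2))
  finally show ?thesis .
qed

section \<open>Trace and entry sum after one epoch\<close>

lemma trace_transpose_mul_self: "trace (transpose C ** C) = (norm C)\<^sup>2" for C :: "real^'n^'m"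
proof -
  have "trace (transpose C ** C) = (\<Sum>j\<in>UNIV. \<Sum>i\<in>UNIV. C $ i $ j * C $ i $ j)"
    by (simp add: trace_def matrix_matrix_mult_def transpose_def)
  also have "\<dots> = (norm C)\<^sup>2"
    by (subst sum.swap) (simp add: power2_norm_eq_inner inner_vec_def)
  finally show ?thesis .
qed

lemma trace_ones_sandwich: "trace (transpose C ** ones_mat ** C) = (norm (transpose C *v 1))\<^sup>2"
  for C :: "real^'n^'n"
  by (simp add: power2_norm_eq_inner inner_vec_def trace_def matrix_matrix_mult_def
      matrix_vector_mult_def transpose_def sum_distrib_right sum_distrib_left)

lemma ones_mat_mul_vec: "ones_mat *v x = (1 \<bullet> x) *\<^sub>R 1"
  by (simp add: vec_eq_iff matrix_vector_mult_def inner_vec_def)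

text \<open>With y = C 1 the left side is the quadratic form y^T X y for X = a I + b 1 1^T, and the
  rank-one part contributes b times the square of 1^T y.\<close>

lemma grand_sum_sandwich:
  fixes C :: "real^'n^'n"
  shows "1 \<bullet> ((transpose C ** (a *\<^sub>R mat 1 + b *\<^sub>R ones_mat) ** C) *v 1)
           = a * (norm (C *v 1))\<^sup>2 + b * (1 \<bullet> (C *v 1))\<^sup>2"
proof -
  let ?X = "a *\<^sub>R mat 1 + b *\<^sub>R ones_mat :: real^'n^'n" and ?y = "C *v 1"
  have "1 \<bullet> ((transpose C ** ?X ** C) *v 1) = (transpose C *v (?X *v ?y)) \<bullet> 1"
    by (simp only: matrix_vector_mul_assoc matrix_mul_assoc inner_commute)
  also have "\<dots> = ?y \<bullet> (?X *v ?y)"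
    by (simp only: transpose_matrix_vector dot_lmul_matrix inner_commute[of _ "?X *v ?y"])
  also have "?X *v ?y = a *\<^sub>R ?y + (b * (1 \<bullet> ?y)) *\<^sub>R 1"
    by (simp add: matrix_vector_mult_add_rdistrib scaleR_matrix_vector_assoc[symmetric]
        ones_mat_mul_vec)
  finally show ?thesis
    by (simp add: inner_right_distrib power2_norm_eq_inner inner_commute[of ?y 1]
        power2_eq_square[of "1 \<bullet> ?y"])
qed

lemma trace_sandwich:
  fixes C :: "real^'n^'n"
  shows "trace (transpose C ** (a *\<^sub>R mat 1 + b *\<^sub>R ones_mat) ** C)
           = a * (norm C)\<^sup>2 + b * (norm (transpose C *v 1))\<^sup>2"
proof -
  have lin: "linear (\<lambda>X. transpose C ** X ** C)" by (rule linear_sandwich)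
  have "trace (c *\<^sub>R X) = c * trace X" for c and X :: "real^'n^'n"
    by (simp add: trace_def sum_distrib_left)
  thus ?thesis
    by (simp add: linear_add[OF lin] linear_scale[OF lin] trace_add trace_transpose_mul_self
        trace_ones_sandwich)
qed

text \<open>Simultaneous relabelling of rows and columns fixes \<open>X\<close>, so the inner
  permutation matrices are absorbed and only the outer pair remains.\<close>

lemma perm_conj_sandwich:
  fixes C :: "real^'n^'n" and a b :: real
  assumes "p permutes UNIV"
  defines "X \<equiv> a *\<^sub>R mat 1 + b *\<^sub>R ones_mat"
  shows "perm_conj (transpose C) p ** X ** perm_conj C p = perm_conj (transpose C ** X ** C) p"
proof -
  have "transpose (perm_mat p) ** X ** perm_mat p = X"
    using permutes_inj[OF assms(1)]
    by (simp add: vec_eq_iff perm_mat_sandwich X_def mat_def inj_eq)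
  moreover have "perm_conj (transpose C) p ** X ** perm_conj C p
      = perm_mat p ** transpose C ** (transpose (perm_mat p) ** X ** perm_mat p) ** C
          ** transpose (perm_mat p)"
    by (simp only: perm_conj_def matrix_mul_assoc)
  ultimately show ?thesis
    by (simp add: perm_conj_def matrix_mul_assoc)
qed

text \<open>The new coefficient of \<open>ones_mat\<close> is (entry sum - trace) / (n (n - 1)),
  which separates into \<open>d2 C\<close> and \<open>m2 C\<close>; subtracting it from trace / n
  gives \<open>d1 C\<close> and \<open>m1 C\<close>.\<close>

lemma expectation_epoch:
  fixes C :: "real^'n^'n"
  assumes "CARD('n) \<ge> 2"
  shows "measure_pmf.expectation random_perm (\<lambda>q. perm_conj (transpose C) q
             ** (a *\<^sub>R mat 1 + b *\<^sub>R ones_mat) ** perm_conj C q)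
           = (d1 C * a + m1 C * b) *\<^sub>R mat 1 + (d2 C * a + m2 C * b) *\<^sub>R ones_mat"
proof -
  let ?Y = "transpose C ** (a *\<^sub>R mat 1 + b *\<^sub>R ones_mat) ** C"
  have "(1 \<bullet> (?Y *v 1) - trace ?Y) / (real CARD('n) * (real CARD('n) - 1)) = d2 C * a + m2 C * b"
    unfolding grand_sum_sandwich trace_sandwich d2_def m2_def
    by (simp add: add_divide_distrib diff_divide_distrib algebra_simps)
  moreover have "trace ?Y / real CARD('n) - (d2 C * a + m2 C * b) = d1 C * a + m1 C * b"
    unfolding trace_sandwich d1_def m1_def
    by (simp add: add_divide_distrib algebra_simps)
  moreover have "measure_pmf.expectation random_perm (\<lambda>q. perm_conj (transpose C) q
             ** (a *\<^sub>R mat 1 + b *\<^sub>R ones_mat) ** perm_conj C q)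
      = measure_pmf.expectation random_perm (perm_conj ?Y)"
    by (intro integral_cong_AE)
       (auto simp: AE_measure_pmf_iff set_random_perm perm_conj_sandwich)
  ultimately show ?thesis
    using expectation_perm_conj[OF assms, of ?Y] by simp
qed

theorem theorem3p2:
  fixes \<delta> :: real and A :: "real^('n::{finite,linorder})^('n::{finite,linorder})"
  assumes "CARD('n) \<ge> 2"
    and "0 < \<delta>" and "\<delta> < real CARD('n) / (real CARD('n) - 1)"
    and "A = \<delta> *\<^sub>R mat 1 + (1 - \<delta>) *\<^sub>R ones_mat"
  shows "\<exists>\<eta> \<nu> :: nat \<Rightarrow> real.
      \<eta> 0 = \<delta> \<and> \<nu> 0 = 1 - \<delta> \<and>
      (\<forall>t. (vector [\<eta> (t + 1), \<nu> (t + 1)] :: real^2)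
              = M_mat (cd_mat A) *v vector [\<eta> t, \<nu> t] \<and>
           M_mat (cd_mat A) *v vector [\<eta> t, \<nu> t]
              = matpow (M_mat (cd_mat A)) (t + 1) *v vector [\<delta>, 1 - \<delta>]) \<and>
      (\<forall>l t. t \<le> l \<longrightarrow> A_bar A l t = \<eta> t *\<^sub>R mat 1 + \<nu> t *\<^sub>R ones_mat)"
proof -
  let ?C = "cd_mat A"
  \<comment> \<open>Taking the closed form as the definition of both sequences makes the recursion a
    consequence of how \<open>matpow\<close> unfolds.\<close>
  define w :: "nat \<Rightarrow> real^2" where "w t = matpow (M_mat ?C) t *v vector [\<delta>, 1 - \<delta>]" for t
  define \<eta> where "\<eta> t = w t $ 1" for t
  define \<nu> where "\<nu> t = w t $ 2" for t
  have w: "vector [\<eta> t, \<nu> t] = w t" for t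
    by (simp add: vec_eq_iff forall_2 \<eta>_def \<nu>_def)
  have init: "\<eta> 0 = \<delta>" "\<nu> 0 = 1 - \<delta>"
    by (simp_all add: \<eta>_def \<nu>_def w_def)
  have w_Suc: "w (Suc t) = M_mat ?C *v w t" for t
    by (simp add: w_def matrix_vector_mul_assoc)
  have rec: "\<eta> (Suc t) = d1 ?C * \<eta> t + m1 ?C * \<nu> t" "\<nu> (Suc t) = d2 ?C * \<eta> t + m2 ?C * \<nu> t" for t
    unfolding \<eta>_def \<nu>_def w_Suc
    by (simp_all add: M_mat_def matrix_vector_mult_def sum_2)
  \<comment> \<open>Induction on \<open>t\<close> with \<open>l\<close> fixed: the premise
    \<open>Suc t \<le> l\<close> supplies the \<open>t < l\<close> required by
    \<open>A_bar_Suc\<close>.\<close>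
  have "A_bar A l t = \<eta> t *\<^sub>R mat 1 + \<nu> t *\<^sub>R ones_mat" if "t \<le> l" for l t
    using that
  proof (induction t)
    case 0
    then show ?case using assms(4) init by simp
  next
    case (Suc t)
    then show ?case
      by (simp add: A_bar_Suc expectation_epoch[OF assms(1)] rec)
  qed
  moreover have "M_mat ?C *v w t = matpow (M_mat ?C) (t + 1) *v vector [\<delta>, 1 - \<delta>]" for t
    using w_Suc[of t] by (simp add: w_def)
  ultimately show ?thesis
    using init w w_Suc by (intro exI[of _ \<eta>] exI[of _ \<nu>]) auto
qed

end
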